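(* For every integer $n \geq 1$, every partition $\lambda$ of $n$, and every integer $k \geq 3$, $$\sum_{u \in \lambda} h(u)^k \leq n^k + \sum_{u \in \lambda} |c(u)|^k,$$ with equality if and only if $\lambda$ is a hook (i.e., $\lambda = H((1,1))$).
   Context: A partition $\lambda$ of $n$ is a weakly decreasing sequence of non-negative integers $\lambda_1 \geq \lambda_2 \geq \cdots$ with sum $n$, identified with its Young diagram: the set of cells $(i,j)$ with $i \ge 1$, $1 \le j \le \lambda_i$. For a cell $u=(i,j) \in \lambda$, the hook $H(u)$ is the set of cells $(k,l) \in \lambda$ such that either $k=i$ and $l \geq j$, or $l=j$ and $k \geq i$; the hook length is $h(u) = |H(u)|$, and the content is $c(u)=j-i$. The partition $\lambda$ is called a hook if its set of cells equals $H((1,1))$. *)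

theory Defs
  imports Main
begin

(* Indices start at 1, so the value at index 0 carries no meaning and is unconstrained. Finite
   support is what it means for a series of natural numbers to have the finite sum n. *)
definition partition_of :: "(nat \<Rightarrow> nat) \<Rightarrow> nat \<Rightarrow> bool" where
  "partition_of lam n \<longleftrightarrow>
     antimono_on {1..} lam \<and>
     finite {i \<in> {1..}. lam i \<noteq> 0} \<and>
     (\<Sum>i \<in> {i \<in> {1..}. lam i \<noteq> 0}. lam i) = n"

definition young_diagram :: "(nat \<Rightarrow> nat) \<Rightarrow> (nat \<times> nat) set" where
  "young_diagram lam = {(i, j). 1 \<le> i \<and> 1 \<le> j \<and> j \<le> lam i}"

definition hook :: "(nat \<Rightarrow> nat) \<Rightarrow> nat \<times> nat \<Rightarrow> (nat \<times> nat) set" where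
  "hook lam = (\<lambda>(i, j). {(k, l) \<in> young_diagram lam. (k = i \<and> j \<le> l) \<or> (l = j \<and> i \<le> k)})"

definition hook_length :: "(nat \<Rightarrow> nat) \<Rightarrow> nat \<times> nat \<Rightarrow> nat" where
  "hook_length lam u = card (hook lam u)"

definition content :: "nat \<times> nat \<Rightarrow> int" where
  "content = (\<lambda>(i, j). int j - int i)"

definition is_hook :: "(nat \<Rightarrow> nat) \<Rightarrow> bool" where
  "is_hook lam \<longleftrightarrow> young_diagram lam = hook lam (1, 1)"

lemma young_diagram_Sigma:
  "young_diagram lam = Sigma {i \<in> {1..}. lam i \<noteq> 0} (\<lambda>i. {1..lam i})"
  by (auto simp: young_diagram_def)

lemma finite_young_diagram: "partition_of lam n \<Longrightarrow> finite (young_diagram lam)"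
  by (simp add: young_diagram_Sigma partition_of_def)

lemma card_young_diagram: "partition_of lam n \<Longrightarrow> card (young_diagram lam) = n"
  by (simp add: young_diagram_Sigma partition_of_def)

end

theory Submission
  imports Defs
begin

text \<open>
  Induct by deleting the principal hook, that is, the first row and the first column. The
  remaining cells form, after a shift by \<open>(1, 1)\<close>, the diagram of a smaller partition \<open>\<mu>\<close>
  (\<open>peel\<close>), and the shift changes neither contents nor hook lengths. So it suffices to
  compare how the two sides grow when the principal hook is put back.

  Let the first row and the first column have \<open>a + 1\<close> and \<open>b + 1\<close> cells, put
  \<open>m = a + b + 1\<close>, the length of the principal hook, let \<open>p\<close> be the number of cells of \<open>\<mu>\<close>, and
  write \<open>G t = (t + 1)^k - t^k\<close> (\<open>power_gap\<close>). If \<open>\<mu>\<close> were empty, the hook lengths in the arm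
  would be \<open>1, \<dots>, a\<close> and those in the leg \<open>1, \<dots>, b\<close>, exactly the absolute contents there.
  In general, a cell \<open>(i, j)\<close> of \<open>\<mu>\<close> lengthens by one the arm hook above it and the leg hook
  to its left. Telescoping along the columns and rows of \<open>\<mu>\<close> charges \<open>G (a - j + i)\<close> and
  \<open>G (b - i + j)\<close> to this cell. Hence (\<open>defect_peel\<close>) the difference of the two sides grows by
  \<open>(m + p)^k - m^k - p^k\<close> minus the sum of \<open>G (a - j + i) + G (b - i + j)\<close> over all cells
  \<open>(i, j)\<close> of \<open>\<mu>\<close>.

  The two arguments of \<open>G\<close> add up to \<open>a + b = m - 1\<close> for every cell. As \<open>G - 1\<close> is a polynomial
  with nonnegative coefficients and no constant term, it is superadditive on the natural
  numbers. With \<open>G 1 = 2^k - 1 \<ge> 7\<close> this makes every summand at most \<open>G m - 5\<close>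
  (\<open>power_gap_arm_leg_bound\<close>), while \<open>(m + p)^k - m^k - p^k \<ge> p * (G m - 1)\<close>
  (\<open>power_add_lower_bound\<close>). So the growth is at least \<open>4 * p\<close>. It vanishes if \<open>\<mu>\<close> is empty,
  that is, if the partition is a hook, and is positive otherwise.
  (For \<open>k = 2\<close> one has \<open>G t = 2 * t + 1\<close> and the growth is always zero: this is the classical
  identity between the squares of hook lengths and of contents.)
\<close>

section \<open>Conjugate partitions and their diagrams\<close>

text \<open>
  This form of the relation between row lengths \<open>f\<close> and column lengths \<open>g\<close> is symmetric, so
  that facts about columns follow from those about rows, and it is inherited by \<open>peel\<close>. It
  also implies that \<open>f\<close> and \<open>g\<close> are weakly decreasing from index \<open>1\<close> on and
  have finite support there, so it can replace \<open>partition_of\<close> in the induction. Values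
  at index \<open>0\<close> are left free.
\<close>
definition conjugate :: "(nat \<Rightarrow> nat) \<Rightarrow> (nat \<Rightarrow> nat) \<Rightarrow> bool" where
  "conjugate f g \<longleftrightarrow> (\<forall>i\<ge>1. \<forall>j\<ge>1. j \<le> f i \<longleftrightarrow> i \<le> g j)"

lemma conjugate_sym: "conjugate f g \<Longrightarrow> conjugate g f"
  by (auto simp: conjugate_def)

lemma conjugateD: "conjugate f g \<Longrightarrow> 1 \<le> i \<Longrightarrow> 1 \<le> j \<Longrightarrow> j \<le> f i \<longleftrightarrow> i \<le> g j"
  by (auto simp: conjugate_def)

text \<open>
  The rows of length at least \<open>j\<close> form an initial segment of the positive integers, so their
  number is the length of the \<open>j\<close>-th column.
\<close>
lemma partition_of_has_conjugate:
  assumes "partition_of lam n"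
  shows "\<exists>g. conjugate lam g"
proof -
  define S where "S j = {i \<in> {1..}. j \<le> lam i}" for j
  have anti: "lam i' \<le> lam i" if "1 \<le> i" "i \<le> i'" for i i'
    using assms that unfolding partition_of_def monotone_on_def by auto
  have fin: "finite (S j)" if "1 \<le> j" for j
    by (rule finite_subset[of _ "{i \<in> {1..}. lam i \<noteq> 0}"])
      (use assms that in \<open>auto simp: S_def partition_of_def\<close>)
  have "j \<le> lam i \<longleftrightarrow> i \<le> card (S j)" if "1 \<le> i" "1 \<le> j" for i j
  proof
    assume "j \<le> lam i"
    then have "{1..i} \<subseteq> S j"
      using anti by (fastforce simp: S_def)
    from card_mono[OF fin[OF \<open>1 \<le> j\<close>] this] show "i \<le> card (S j)" by simp
  next
    assume le: "i \<le> card (S j)"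
    show "j \<le> lam i"
    proof (rule ccontr)
      assume "\<not> j \<le> lam i"
      then have "S j \<subseteq> {1..<i}"
        using anti[of i] \<open>1 \<le> i\<close> by (fastforce simp: S_def not_le)
      from card_mono[OF _ this] le \<open>1 \<le> i\<close> show False by simp
    qed
  qed
  then have "conjugate lam (\<lambda>j. card (S j))"
    by (simp add: conjugate_def)
  then show ?thesis by (rule exI[where x = "\<lambda>j. card (S j)"])
qed

text \<open>Transposing a diagram is what turns statements about arms into statements about legs.\<close>
lemma young_diagram_conjugate:
  assumes "conjugate f g"
  shows "young_diagram f = (\<lambda>(j, i). (i, j)) ` young_diagram g"
proof (rule set_eqI, clarify)
  fix i j
  have "(i, j) \<in> young_diagram f \<longleftrightarrow> (j, i) \<in> young_diagram g"
    using conjugateD[OF assms, of i j] by (auto simp: young_diagram_def)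
  then show "(i, j) \<in> young_diagram f \<longleftrightarrow> (i, j) \<in> (\<lambda>(j, i). (i, j)) ` young_diagram g"
    by force
qed

lemma finite_young_diagram_conjugate:
  assumes "conjugate f g"
  shows "finite (young_diagram f)"
proof (rule finite_subset)
  show "young_diagram f \<subseteq> {1..g 1} \<times> {1..f 1}"
  proof clarify
    fix i j assume "(i, j) \<in> young_diagram f"
    then have ij: "1 \<le> i" "1 \<le> j" "j \<le> f i" by (auto simp: young_diagram_def)
    with conjugateD[OF assms, of i j] have "i \<le> g j" by simp
    then have "j \<le> f 1" "i \<le> g 1"
      using ij conjugateD[OF assms, of 1 j] conjugateD[OF assms, of i 1] by auto
    with ij show "i \<in> {1..g 1} \<and> j \<in> {1..f 1}" by simp
  qed
qed simp

lemma hook_length_conjugate: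
  assumes "conjugate f g" and "(i, j) \<in> young_diagram f"
  shows "hook_length f (i, j) = (f i - j) + (g j - i) + 1"
proof -
  have ij: "1 \<le> i" "1 \<le> j" "j \<le> f i" using assms(2) by (auto simp: young_diagram_def)
  have "hook f (i, j) = Pair i ` {j..f i} \<union> (\<lambda>k. (k, j)) ` {Suc i..g j}"
    using ij conjugateD[OF assms(1), of _ j]
    by (auto simp: hook_def young_diagram_def image_iff)
  moreover have "card (Pair i ` {j..f i} \<union> (\<lambda>k. (k, j)) ` {Suc i..g j})
      = card {j..f i} + card {Suc i..g j}"
    by (subst card_Un_disjoint) (auto simp: card_image inj_on_def)
  ultimately show ?thesis
    using ij by (simp add: hook_length_def)
qed

section \<open>Removing the principal hook\<close>

text \<open>
  Row lengths after deletion of the first row and the first column. Truncated subtraction keeps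
  rows that are already empty at length \<open>0\<close>.
\<close>
definition peel :: "(nat \<Rightarrow> nat) \<Rightarrow> nat \<Rightarrow> nat" where
  "peel f i = f (i + 1) - 1"

lemma conjugate_peel:
  assumes "conjugate f g"
  shows "conjugate (peel f) (peel g)"
proof -
  have "j \<le> peel f i \<longleftrightarrow> i \<le> peel g j" if "1 \<le> i" "1 \<le> j" for i j
    using conjugateD[OF assms, of "i + 1" "j + 1"] that unfolding peel_def by linarith
  then show ?thesis by (simp add: conjugate_def)
qed

lemma young_diagram_peel:
  "(i, j) \<in> young_diagram (peel f) \<longleftrightarrow> 1 \<le> i \<and> 1 \<le> j \<and> (i + 1, j + 1) \<in> young_diagram f"
  unfolding young_diagram_def peel_def by simp arith

lemma is_hook_iff_peel_empty: "is_hook f \<longleftrightarrow> young_diagram (peel f) = {}"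
proof -
  have hook: "hook f (1, 1) = {(i, j) \<in> young_diagram f. i = 1 \<or> j = 1}"
    by (auto simp: hook_def young_diagram_def)
  have "is_hook f \<longleftrightarrow> (\<forall>i j. (i, j) \<in> young_diagram f \<longrightarrow> i = 1 \<or> j = 1)"
    unfolding is_hook_def hook by blast
  also have "\<dots> \<longleftrightarrow> (\<forall>i j. (i, j) \<notin> young_diagram (peel f))"
  proof (intro iffI allI impI)
    fix i j
    assume "\<forall>i j. (i, j) \<in> young_diagram f \<longrightarrow> i = 1 \<or> j = 1"
    then have "(i + 1, j + 1) \<in> young_diagram f \<longrightarrow> i + 1 = 1 \<or> j + 1 = 1" by blast
    then show "(i, j) \<notin> young_diagram (peel f)"
      unfolding young_diagram_peel by auto
  next
    fix i j
    assume "\<forall>i j. (i, j) \<notin> young_diagram (peel f)" and ij: "(i, j) \<in> young_diagram f"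
    then have "(i - 1, j - 1) \<notin> young_diagram (peel f)" by simp
    moreover have "1 \<le> i" "1 \<le> j" using ij by (auto simp: young_diagram_def)
    ultimately show "i = 1 \<or> j = 1"
      using ij unfolding young_diagram_peel by auto
  qed
  finally show ?thesis by auto
qed

text \<open>Corner, arm, leg and the shifted smaller diagram are disjoint and cover the diagram.\<close>
lemma sum_young_diagram_peel:
  fixes \<phi> :: "nat \<times> nat \<Rightarrow> 'a::comm_monoid_add"
  assumes "conjugate f g" and "1 \<le> f 1"
  shows "(\<Sum>u\<in>young_diagram f. \<phi> u) = \<phi> (1, 1) + (\<Sum>j=1..f 1 - 1. \<phi> (1, j + 1))
    + (\<Sum>i=1..g 1 - 1. \<phi> (i + 1, 1)) + (\<Sum>(i, j)\<in>young_diagram (peel f). \<phi> (i + 1, j + 1))"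
proof -
  let ?arm = "(\<lambda>j. (1::nat, j + 1)) ` {1..f 1 - 1}" and ?leg = "(\<lambda>i. (i + 1, 1::nat)) ` {1..g 1 - 1}"
    and ?rest = "(\<lambda>(i, j). (i + 1, j + 1)) ` young_diagram (peel f)"
  have fin: "finite (young_diagram (peel f))"
    using finite_young_diagram_conjugate[OF conjugate_peel[OF assms(1)]] .
  have "young_diagram f = {(1, 1)} \<union> ?arm \<union> ?leg \<union> ?rest"
  proof (rule set_eqI, clarify)
    fix i j :: nat
    have "i = 0 \<or> i = 1 \<or> (\<exists>i'. i = i' + 1 \<and> 1 \<le> i')" for i :: nat
      by presburger
    from this[of i] this[of j]
    consider "i = 0 \<or> j = 0" | "i = 1" "j = 1" | j' where "i = 1" "j = j' + 1" "1 \<le> j'"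
      | i' where "i = i' + 1" "j = 1" "1 \<le> i'"
      | i' j' where "i = i' + 1" "j = j' + 1" "1 \<le> i'" "1 \<le> j'"
      by blast
    then show "(i, j) \<in> young_diagram f \<longleftrightarrow> (i, j) \<in> {(1, 1)} \<union> ?arm \<union> ?leg \<union> ?rest"
    proof cases
      case 4
      have "(i, j) \<in> young_diagram f \<longleftrightarrow> i \<le> g 1"
        using 4 conjugateD[OF assms(1), of i 1] by (auto simp: young_diagram_def)
      with 4 show ?thesis by (auto simp: image_iff young_diagram_peel)
    qed (use assms(2) in \<open>auto simp: young_diagram_def peel_def image_iff\<close>)
  qed
  moreover have "(\<Sum>u\<in>{(1, 1)} \<union> ?arm \<union> ?leg \<union> ?rest. \<phi> u)
      = (\<Sum>u\<in>{(1, 1)}. \<phi> u) + (\<Sum>u\<in>?arm. \<phi> u) + (\<Sum>u\<in>?leg. \<phi> u) + (\<Sum>u\<in>?rest. \<phi> u)"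
  proof -
    have "({(1, 1)} \<union> ?arm \<union> ?leg) \<inter> ?rest = {}" "({(1, 1)} \<union> ?arm) \<inter> ?leg = {}"
      "{(1, 1)} \<inter> ?arm = {}"
      by (auto simp: young_diagram_def)
    with fin show ?thesis by (simp only: sum.union_disjoint finite_Un finite_imageI
      finite_atLeastAtMost finite.emptyI finite.insertI simp_thms)
  qed
  ultimately have "(\<Sum>u\<in>young_diagram f. \<phi> u)
      = (\<Sum>u\<in>{(1, 1)}. \<phi> u) + (\<Sum>u\<in>?arm. \<phi> u) + (\<Sum>u\<in>?leg. \<phi> u) + (\<Sum>u\<in>?rest. \<phi> u)"
    by (simp only:)
  also have "(\<Sum>u\<in>?rest. \<phi> u) = (\<Sum>(i, j)\<in>young_diagram (peel f). \<phi> (i + 1, j + 1))"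
    by (subst sum.reindex) (auto simp: inj_on_def case_prod_unfold)
  also have "(\<Sum>u\<in>?arm. \<phi> u) = (\<Sum>j=1..f 1 - 1. \<phi> (1, j + 1))"
    by (subst sum.reindex) (auto simp: inj_on_def)
  also have "(\<Sum>u\<in>?leg. \<phi> u) = (\<Sum>i=1..g 1 - 1. \<phi> (i + 1, 1))"
    by (subst sum.reindex) (auto simp: inj_on_def)
  finally show ?thesis by simp
qed

section \<open>Gaps between consecutive powers\<close>

definition power_gap :: "nat \<Rightarrow> nat \<Rightarrow> int" where
  "power_gap k t = (int t + 1) ^ k - int t ^ k"

text \<open>
  Telescoping: a hook of length \<open>x + 1\<close> is lengthened by \<open>p\<close> cells, one at a time.
\<close>
lemma sum_power_gap:
  "(\<Sum>i=1..p. power_gap k (x + i)) = (int x + 1 + int p) ^ k - (int x + 1) ^ k"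
  by (induction p) (auto simp: power_gap_def algebra_simps)

text \<open>
  By the binomial theorem, \<open>power_gap k t - 1\<close> is a combination, with nonnegative
  coefficients, of the powers \<open>t ^ j\<close> with \<open>1 \<le> j < k\<close>, each of which is superadditive.
  For \<open>k = 0\<close> the gap is zero.
\<close>
lemma power_gap_superadditive:
  "power_gap k x + power_gap k y \<le> power_gap k (x + y) + 1"
proof (cases k)
  case (Suc l)
  have pow: "int x ^ j + int y ^ j \<le> int (x + y) ^ j" if "1 \<le> j" for j
    using that
  proof (induction j rule: dec_induct)
    case (step j)
    have "int x * int x ^ j + int y * int y ^ j \<le> (int x + int y) * (int x ^ j + int y ^ j)"
      by (simp add: algebra_simps)
    also have "\<dots> \<le> (int x + int y) * int (x + y) ^ j"
      using step.IH by (intro mult_left_mono) auto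
    finally show ?case by simp
  qed simp
  have expand: "power_gap k t = 1 + (\<Sum>j=1..l. of_nat (k choose j) * int t ^ j)" for t
    unfolding power_gap_def binomial_ring Suc
    by (simp add: atMost_atLeast0 sum.atLeast_Suc_atMost)
  have "(\<Sum>j=1..l. of_nat (k choose j) * int x ^ j) + (\<Sum>j=1..l. of_nat (k choose j) * int y ^ j)
      \<le> (\<Sum>j=1..l. of_nat (k choose j) * int (x + y) ^ j)"
    unfolding sum.distrib[symmetric] distrib_left[symmetric]
    by (intro sum_mono mult_left_mono pow) auto
  then show ?thesis by (simp add: expand)
qed (simp add: power_gap_def)

text \<open>
  The bound for one cell of the smaller diagram, where \<open>x + y + 1\<close> is the length of the principal
  hook. Splitting \<open>x + y + 1\<close> into \<open>x\<close>, \<open>y\<close> and \<open>1\<close> costs \<open>2\<close> and leaves the summand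
  \<open>power_gap k 1 = 2 ^ k - 1\<close>. This is at least \<open>7\<close> only because \<open>k \<ge> 3\<close>, and \<open>7 - 2 = 5\<close> is the
  source of strictness.
\<close>
lemma power_gap_arm_leg_bound:
  assumes "k \<ge> 3"
  shows "power_gap k x + power_gap k y + 5 \<le> power_gap k (x + y + 1)"
proof -
  have "(2::int) ^ 3 \<le> 2 ^ k" using assms by (intro power_increasing) auto
  then have "7 \<le> power_gap k 1" using assms by (simp add: power_gap_def)
  with power_gap_superadditive[of k x y] power_gap_superadditive[of k "x + y" 1]
  show ?thesis by simp
qed

text \<open>
  Raising \<open>p\<close> by one increases \<open>(m + p) ^ k - p ^ k\<close> by \<open>power_gap k (m + p) - power_gap k p\<close>,
  which superadditivity bounds below by \<open>power_gap k m - 1\<close>.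
\<close>
lemma power_add_lower_bound:
  assumes "k > 0"
  shows "int m ^ k + int p ^ k + int p * (power_gap k m - 1) \<le> int (m + p) ^ k"
proof (induction p)
  case (Suc p)
  have "int m ^ k + int (Suc p) ^ k + int (Suc p) * (power_gap k m - 1)
      = (int m ^ k + int p ^ k + int p * (power_gap k m - 1))
        + (power_gap k p + power_gap k m - 1)"
    by (simp add: power_gap_def algebra_simps)
  also have "\<dots> \<le> int (m + p) ^ k + power_gap k (m + p)"
    using Suc power_gap_superadditive[of k m p] by simp
  also have "\<dots> = int (m + Suc p) ^ k"
    by (simp add: power_gap_def algebra_simps)
  finally show ?case .
qed (use assms in \<open>simp add: zero_power\<close>)

section \<open>How the two sides grow with the principal hook\<close>

text \<open>
  The arm cell in column \<open>j + 1\<close> has \<open>f 1 - 1 - j\<close> cells to its right and \<open>peel g j\<close> below it.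
  Adding the latter one by one, the \<open>i\<close>-th of them raises the hook length from
  \<open>f 1 - 1 - j + i\<close> to its successor, so its contribution can be charged to the cell
  \<open>(i, j)\<close> of the smaller diagram.
\<close>
lemma sum_arm_hook_power:
  assumes "conjugate f g" and "1 \<le> f 1"
  shows "(\<Sum>j=1..f 1 - 1. int (hook_length f (1, j + 1)) ^ k)
    = (\<Sum>j=1..f 1 - 1. int j ^ k)
      + (\<Sum>(i, j)\<in>young_diagram (peel f). power_gap k (f 1 - 1 - j + i))"
proof -
  define a where "a = f 1 - 1"
  have hl: "int (hook_length f (1, j + 1)) ^ k
      = int (a + 1 - j) ^ k + (\<Sum>i=1..peel g j. power_gap k (a - j + i))"
    if "j \<in> {1..a}" for j
  proof -
    have "(1, j + 1) \<in> young_diagram f"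
      using that by (auto simp: young_diagram_def a_def)
    moreover have "1 \<le> g (j + 1)"
      using conjugateD[OF assms(1), of 1 "j + 1"] that by (auto simp: a_def)
    ultimately have "hook_length f (1, j + 1) = (a - j) + 1 + peel g j"
      using hook_length_conjugate[OF assms(1)] by (simp add: peel_def a_def)
    then have "int (hook_length f (1, j + 1)) = int (a - j) + 1 + int (peel g j)"
      by simp
    moreover have "int (a + 1 - j) = int (a - j) + 1" using that by simp
    ultimately show ?thesis
      unfolding sum_power_gap by simp
  qed
  have diag: "young_diagram (peel f) = (\<lambda>(j, i). (i, j)) ` Sigma {1..a} (\<lambda>j. {1..peel g j})"
  proof (rule set_eqI, clarify)
    fix i j
    have "j \<le> a" if "1 \<le> i" "1 \<le> j" "i \<le> peel g j"
      using that conjugateD[OF assms(1), of 1 "j + 1"] by (auto simp: peel_def a_def)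
    then show "(i, j) \<in> young_diagram (peel f)
        \<longleftrightarrow> (i, j) \<in> (\<lambda>(j, i). (i, j)) ` Sigma {1..a} (\<lambda>j. {1..peel g j})"
      using conjugateD[OF conjugate_peel[OF assms(1)], of i j]
      by (auto simp: young_diagram_def image_iff)
  qed
  have "(\<Sum>j=1..a. int (hook_length f (1, j + 1)) ^ k)
      = (\<Sum>j=1..a. int (a + 1 - j) ^ k) + (\<Sum>j=1..a. \<Sum>i=1..peel g j. power_gap k (a - j + i))"
    by (subst sum.distrib[symmetric], rule sum.cong[OF refl hl])
  \<comment> \<open>Without the cells below, the hooks of the arm have lengths \<open>a, \<dots>, 1\<close>; its contents
    are \<open>1, \<dots>, a\<close>.\<close>
  also have "(\<Sum>j=1..a. int (a + 1 - j) ^ k) = (\<Sum>j=1..a. int j ^ k)"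
    by (rule sum.reindex_bij_witness[of _ "\<lambda>j. a + 1 - j" "\<lambda>j. a + 1 - j"]) auto
  also have "(\<Sum>j=1..a. \<Sum>i=1..peel g j. power_gap k (a - j + i))
      = (\<Sum>(i, j)\<in>young_diagram (peel f). power_gap k (a - j + i))"
    unfolding diag
    by (subst sum.reindex) (auto simp: inj_on_def sum.Sigma case_prod_unfold intro!: sum.cong)
  finally show ?thesis
    by (simp add: a_def)
qed

lemma hook_length_swap:
  assumes "conjugate f g" and "(i, j) \<in> young_diagram f"
  shows "hook_length f (i, j) = hook_length g (j, i)"
proof -
  have "(j, i) \<in> young_diagram g"
    using assms conjugateD[OF assms(1), of i j] by (auto simp: young_diagram_def)
  then show ?thesis
    using hook_length_conjugate[OF conjugate_sym[OF assms(1)], of j i]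
      hook_length_conjugate[OF assms] by simp
qed

lemma sum_leg_hook_power:
  assumes "conjugate f g" and "1 \<le> f 1"
  shows "(\<Sum>i=1..g 1 - 1. int (hook_length f (i + 1, 1)) ^ k)
    = (\<Sum>i=1..g 1 - 1. int i ^ k)
      + (\<Sum>(i, j)\<in>young_diagram (peel f). power_gap k (g 1 - 1 - i + j))"
proof -
  note sym = conjugate_sym[OF assms(1)]
  have "1 \<le> g 1" using conjugateD[OF assms(1), of 1 1] assms(2) by simp
  note arm = sum_arm_hook_power[OF sym this, of k]
  have "(\<Sum>i=1..g 1 - 1. int (hook_length f (i + 1, 1)) ^ k)
      = (\<Sum>i=1..g 1 - 1. int (hook_length g (1, i + 1)) ^ k)"
  proof (rule sum.cong[OF refl])
    fix i assume "i \<in> {1..g 1 - 1}"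
    then have "(i + 1, 1) \<in> young_diagram f"
      using conjugateD[OF assms(1), of "i + 1" 1] by (auto simp: young_diagram_def)
    from hook_length_swap[OF assms(1) this]
    show "int (hook_length f (i + 1, 1)) ^ k = int (hook_length g (1, i + 1)) ^ k" by simp
  qed
  also note arm
  also have "(\<Sum>(j, i)\<in>young_diagram (peel g). power_gap k (g 1 - 1 - i + j))
      = (\<Sum>(i, j)\<in>young_diagram (peel f). power_gap k (g 1 - 1 - i + j))"
    unfolding young_diagram_conjugate[OF conjugate_peel[OF assms(1)]]
    by (subst sum.reindex) (auto simp: inj_on_def case_prod_unfold)
  finally show ?thesis .
qed

definition defect :: "nat \<Rightarrow> (nat \<Rightarrow> nat) \<Rightarrow> int" where
  "defect k f = int (card (young_diagram f)) ^ k + (\<Sum>u\<in>young_diagram f. \<bar>content u\<bar> ^ k)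
     - (\<Sum>u\<in>young_diagram f. int (hook_length f u) ^ k)"

text \<open>
  On the cells away from the principal hook, contents and hook lengths agree with those of the
  smaller diagram. On its arm and leg, the powers of the contents cancel the part of the
  powers of the hook lengths that does not depend on the smaller diagram.
\<close>
lemma defect_peel:
  assumes "conjugate f g" and "1 \<le> f 1" and "k > 0"
  defines "m \<equiv> f 1 + g 1 - 1" and "p \<equiv> card (young_diagram (peel f))"
  shows "card (young_diagram f) = m + p"
    and "defect k f = defect k (peel f) + (int (m + p) ^ k - int m ^ k - int p ^ k)
      - (\<Sum>(i, j)\<in>young_diagram (peel f).
          power_gap k (f 1 - 1 - j + i) + power_gap k (g 1 - 1 - i + j))"
proof -
  note peel = sum_young_diagram_peel[OF assms(1,2)]
  have g1: "1 \<le> g 1" using conjugateD[OF assms(1), of 1 1] assms(2) by simp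
  have "(\<Sum>u\<in>young_diagram f. 1) = m + p"
    unfolding peel using assms(2) g1 by (simp add: m_def p_def case_prod_unfold)
  then show card: "card (young_diagram f) = m + p" by simp
  have content: "(\<Sum>u\<in>young_diagram f. \<bar>content u\<bar> ^ k)
      = (\<Sum>j=1..f 1 - 1. int j ^ k) + (\<Sum>i=1..g 1 - 1. int i ^ k)
        + (\<Sum>u\<in>young_diagram (peel f). \<bar>content u\<bar> ^ k)"
    unfolding peel using assms(3) by (simp add: content_def case_prod_unfold)
  have h11: "hook_length f (1, 1) = m"
    using hook_length_conjugate[OF assms(1), of 1 1] assms(2) g1
    by (simp add: young_diagram_def m_def)
  have rest: "(\<Sum>(i, j)\<in>young_diagram (peel f). int (hook_length f (i + 1, j + 1)) ^ k)
      = (\<Sum>u\<in>young_diagram (peel f). int (hook_length (peel f) u) ^ k)"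
  proof (rule sum.cong[OF refl], clarify)
    fix i j assume ij: "(i, j) \<in> young_diagram (peel f)"
    then have "(i + 1, j + 1) \<in> young_diagram f" by (simp add: young_diagram_peel)
    from hook_length_conjugate[OF assms(1) this]
      hook_length_conjugate[OF conjugate_peel[OF assms(1)] ij]
    show "int (hook_length f (i + 1, j + 1)) ^ k = int (hook_length (peel f) (i, j)) ^ k"
      by (simp add: peel_def)
  qed
  have hooks: "(\<Sum>u\<in>young_diagram f. int (hook_length f u) ^ k)
      = int m ^ k + (\<Sum>j=1..f 1 - 1. int j ^ k) + (\<Sum>i=1..g 1 - 1. int i ^ k)
        + (\<Sum>(i, j)\<in>young_diagram (peel f).
            power_gap k (f 1 - 1 - j + i) + power_gap k (g 1 - 1 - i + j))
        + (\<Sum>u\<in>young_diagram (peel f). int (hook_length (peel f) u) ^ k)"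
    unfolding peel rest sum_arm_hook_power[OF assms(1,2)] sum_leg_hook_power[OF assms(1,2)] h11
    by (simp add: case_prod_unfold sum.distrib)
  show "defect k f = defect k (peel f) + (int (m + p) ^ k - int m ^ k - int p ^ k)
      - (\<Sum>(i, j)\<in>young_diagram (peel f).
          power_gap k (f 1 - 1 - j + i) + power_gap k (g 1 - 1 - i + j))"
    unfolding defect_def[of k f] card content hooks by (simp add: defect_def p_def)
qed

text \<open>
  The two gaps charged to a cell have arguments whose sum does not depend on the cell, because
  its content enters them with opposite signs. So a single bound serves for all cells.
\<close>
lemma defect_peel_bound:
  assumes "conjugate f g" and "1 \<le> f 1" and "k \<ge> 3"
  shows "defect k (peel f) + 4 * int (card (young_diagram (peel f))) \<le> defect k f"
proof -
  let ?D = "young_diagram (peel f)"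
  define m where "m = f 1 + g 1 - 1"
  have g1: "1 \<le> g 1" using conjugateD[OF assms(1), of 1 1] assms(2) by simp
  have "(\<Sum>(i, j)\<in>?D. power_gap k (f 1 - 1 - j + i) + power_gap k (g 1 - 1 - i + j))
      \<le> (\<Sum>u\<in>?D. power_gap k m - 5)"
  proof (rule sum_mono, clarify)
    fix i j assume "(i, j) \<in> ?D"
    then have ij: "1 \<le> i" "1 \<le> j" "j + 1 \<le> f (i + 1)"
      by (auto simp: young_diagram_def peel_def)
    then have "i + 1 \<le> g (j + 1)" using conjugateD[OF assms(1), of "i + 1" "j + 1"] by simp
    then have "j + 1 \<le> f 1" "i + 1 \<le> g 1"
      using ij conjugateD[OF assms(1), of 1 "j + 1"] conjugateD[OF assms(1), of "i + 1" 1]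
      by auto
    then have "(f 1 - 1 - j + i) + (g 1 - 1 - i + j) + 1 = m"
      by (simp add: m_def)
    with power_gap_arm_leg_bound[OF assms(3), of "f 1 - 1 - j + i" "g 1 - 1 - i + j"]
    show "power_gap k (f 1 - 1 - j + i) + power_gap k (g 1 - 1 - i + j) \<le> power_gap k m - 5"
      by simp
  qed
  also have "\<dots> = int (card ?D) * (power_gap k m - 1) - 4 * int (card ?D)"
    by (simp add: algebra_simps)
  finally show ?thesis
    using defect_peel(2)[OF assms(1,2), of k] power_add_lower_bound[of k m "card ?D"] assms(3)
    unfolding m_def by simp
qed

section \<open>The inequality and its equality case\<close>

lemma defect_empty: "k > 0 \<Longrightarrow> young_diagram f = {} \<Longrightarrow> defect k f = 0"
  by (simp add: defect_def)

lemma defect_nonneg: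
  assumes "conjugate f g" and "k \<ge> 3"
  shows "0 \<le> defect k f"
  using assms(1)
proof (induction "card (young_diagram f)" arbitrary: f g rule: less_induct)
  case less
  show ?case
  proof (cases "1 \<le> f 1")
    case True
    have "1 \<le> g 1" using conjugateD[OF less.prems, of 1 1] True by simp
    then have "card (young_diagram (peel f)) < card (young_diagram f)"
      using defect_peel(1)[OF less.prems True, of k] True assms(2) by simp
    from less.hyps[OF this conjugate_peel[OF less.prems]]
    show ?thesis using defect_peel_bound[OF less.prems True assms(2)] by simp
  next
    case False
    have "young_diagram f = {}"
    proof (rule equals0I, clarify)
      fix i j assume "(i, j) \<in> young_diagram f"
      then have ij: "1 \<le> i" "1 \<le> j" "j \<le> f i" by (auto simp: young_diagram_def)
      with conjugateD[OF less.prems, of i j] have "1 \<le> g j" by simp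
      with conjugateD[OF less.prems, of 1 j] ij False show False by simp
    qed
    then show ?thesis using assms(2) by (simp add: defect_empty)
  qed
qed

lemma defect_eq_0_iff:
  assumes "conjugate f g" and "1 \<le> f 1" and "k \<ge> 3"
  shows "defect k f = 0 \<longleftrightarrow> young_diagram (peel f) = {}"
proof
  assume "defect k f = 0"
  then have "card (young_diagram (peel f)) = 0"
    using defect_peel_bound[OF assms] defect_nonneg[OF conjugate_peel[OF assms(1)] assms(3)]
    by simp
  then show "young_diagram (peel f) = {}"
    using finite_young_diagram_conjugate[OF conjugate_peel[OF assms(1)]] by simp
next
  assume "young_diagram (peel f) = {}"
  then show "defect k f = 0"
    using defect_peel(2)[OF assms(1,2), of k] assms(3) by (simp add: defect_empty)
qed

theorem proposition4p1:
  fixes n k :: nat and lam :: "nat \<Rightarrow> nat"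
  assumes "n \<ge> 1" and "partition_of lam n" and "k \<ge> 3"
  shows "(\<Sum>u \<in> young_diagram lam. int (hook_length lam u) ^ k)
           \<le> int n ^ k + (\<Sum>u \<in> young_diagram lam. \<bar>content u\<bar> ^ k)
       \<and> ((\<Sum>u \<in> young_diagram lam. int (hook_length lam u) ^ k)
            = int n ^ k + (\<Sum>u \<in> young_diagram lam. \<bar>content u\<bar> ^ k)
          \<longleftrightarrow> is_hook lam)"
proof -
  obtain g where g: "conjugate lam g"
    using partition_of_has_conjugate[OF assms(2)] by blast
  have card: "card (young_diagram lam) = n"
    using card_young_diagram[OF assms(2)] .
  then have "young_diagram lam \<noteq> {}" using assms(1) by auto
  then obtain i j where ij: "1 \<le> i" "1 \<le> j" "j \<le> lam i"
    by (auto simp: young_diagram_def)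
  with conjugateD[OF g, of i j] conjugateD[OF g, of 1 j] have "1 \<le> lam 1" by simp
  from defect_eq_0_iff[OF g this assms(3)] defect_nonneg[OF g assms(3)]
  show ?thesis
    unfolding is_hook_iff_peel_empty defect_def card by auto
qed

end
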